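(* Let $E$ be a Banach lattice with order continuous norm, and let $T:E\to E$ be an operator. Then the following assertions are equivalent: (1) $T$ is uo-demi Dunford–Pettis. (2) For every weak Cauchy sequence $(x_n)$ in $E$ such that the sequence $(x_n-T(x_n))$ is un-null, the sequence $(x_n)$ is norm convergent.
   Context: All Banach lattices are real; "operator" means bounded linear map. A net $(x_\alpha)$ in a Banach lattice $E$ is uo-convergent (unbounded order convergent) to $x$ if $|x_\alpha-x|\wedge y$ converges in order to $0$ for every $y\in E^+$, and un-convergent (unbounded norm convergent) to $x$ if $\||x_\alpha-x|\wedge y\|\to0$ for every $y\in E^+$; it is un-null if it un-converges to $0$. An operator $T:E\to E$ on a Banach lattice $E$ is uo-demi Dunford–Pettis (unbounded order demi Dunford–Pettis) if for every weakly null sequence $(x_n)$ in $E$ such that $(x_n-T(x_n))$ is uo-convergent to $0$, one has $\|x_n\|\to0$. A norm is order continuous if $x_\alpha\downarrow0$ implies $\|x_\alpha\|\to0$. *)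

theory Defs
  imports "HOL-Analysis.Analysis" "HOL-Library.Lattice_Algebras"
begin

class banach_lattice = banach + ordered_real_vector + lattice_ab_group_add_abs +
  assumes norm_mono_abs: "\<bar>x\<bar> \<le> \<bar>y\<bar> \<Longrightarrow> norm x \<le> norm y"

instance real :: banach_lattice
  by standard simp

definition directed_on :: "'i set \<Rightarrow> ('i \<Rightarrow> 'i \<Rightarrow> bool) \<Rightarrow> bool" where
  "directed_on I r \<longleftrightarrow>
     I \<noteq> {} \<and>
     (\<forall>i\<in>I. r i i) \<and>
     (\<forall>i\<in>I. \<forall>j\<in>I. \<forall>k\<in>I. r i j \<longrightarrow> r j k \<longrightarrow> r i k) \<and>
     (\<forall>i\<in>I. \<forall>j\<in>I. \<exists>k\<in>I. r i k \<and> r j k)"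

definition net_filter :: "'i set \<Rightarrow> ('i \<Rightarrow> 'i \<Rightarrow> bool) \<Rightarrow> 'i filter" where
  "net_filter I r = (INF i\<in>I. principal {j \<in> I. r i j})"

lemma eventually_net_filter:
  assumes "directed_on I r"
  shows "eventually P (net_filter I r) \<longleftrightarrow> (\<exists>i\<in>I. \<forall>j\<in>I. r i j \<longrightarrow> P j)"
proof -
  have "eventually P (net_filter I r) \<longleftrightarrow>
      (\<exists>i\<in>I. eventually P (principal {j \<in> I. r i j}))"
    unfolding net_filter_def
  proof (rule eventually_INF_base)
    show "I \<noteq> {}" using assms by (simp add: directed_on_def)
    fix a b assume ab: "a \<in> I" "b \<in> I"
    then obtain k where "k \<in> I" "r a k" "r b k"
      using assms unfolding directed_on_def by blast
    moreover have "\<And>j. j \<in> I \<Longrightarrow> r k j \<Longrightarrow> r a j \<and> r b j"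
      using assms ab calculation unfolding directed_on_def by blast
    ultimately show "\<exists>x\<in>I. principal {j \<in> I. r x j}
        \<le> inf (principal {j \<in> I. r a j}) (principal {j \<in> I. r b j})"
      by (intro bexI[of _ k]) auto
  qed
  then show ?thesis by (auto simp: eventually_principal)
qed

definition decreases_to_0 ::
  "'i set \<Rightarrow> ('i \<Rightarrow> 'i \<Rightarrow> bool) \<Rightarrow> ('i \<Rightarrow> 'a::banach_lattice) \<Rightarrow> bool" where
  "decreases_to_0 I r y \<longleftrightarrow>
     directed_on I r \<and>
     (\<forall>i\<in>I. \<forall>j\<in>I. r i j \<longrightarrow> y j \<le> y i) \<and>
     (\<forall>i\<in>I. 0 \<le> y i) \<and>
     (\<forall>z. (\<forall>i\<in>I. z \<le> y i) \<longrightarrow> z \<le> 0)"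

text \<open>
  HOL cannot quantify over index types inside a definition.  Decreasing nets are therefore
  indexed here by subsets of the lattice itself; this is no restriction, since a decreasing net
  can be replaced by its range, directed downwards. See \<open>order_continuous_normD\<close> and
  \<open>order_convergesI\<close> below, where the index type is arbitrary.
\<close>

definition order_continuous_norm :: "'a::banach_lattice itself \<Rightarrow> bool" where
  "order_continuous_norm _ \<longleftrightarrow>
     (\<forall>(I :: 'a set) r (x :: 'a \<Rightarrow> 'a).
        decreases_to_0 I r x \<longrightarrow> ((\<lambda>i. norm (x i)) \<longlongrightarrow> 0) (net_filter I r))"

lemma decreases_to_0_range:
  assumes "decreases_to_0 I r y"
  shows "decreases_to_0 (y ` I) (\<ge>) (\<lambda>d. d)"
proof -
  have ne: "I \<noteq> {}"
    and ub: "\<And>i j. i \<in> I \<Longrightarrow> j \<in> I \<Longrightarrow> \<exists>k\<in>I. r i k \<and> r j k"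
    and mono: "\<And>i j. i \<in> I \<Longrightarrow> j \<in> I \<Longrightarrow> r i j \<Longrightarrow> y j \<le> y i"
    and nonneg: "\<And>i. i \<in> I \<Longrightarrow> 0 \<le> y i"
    and glb: "\<And>z. (\<And>i. i \<in> I \<Longrightarrow> z \<le> y i) \<Longrightarrow> z \<le> 0"
    using assms unfolding decreases_to_0_def directed_on_def by blast+
  have "\<exists>k\<in>I. y k \<le> y i \<and> y k \<le> y j" if ij: "i \<in> I" "j \<in> I" for i j
  proof -
    obtain k where k: "k \<in> I" "r i k" "r j k" using ub[OF ij] by blast
    then show ?thesis using mono[OF ij(1) k(1)] mono[OF ij(2) k(1)] by blast
  qed
  then have "directed_on (y ` I) (\<ge>)"
    unfolding directed_on_def using ne by (simp add: ball_simps) (meson order_trans)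
  then show ?thesis
    unfolding decreases_to_0_def using nonneg glb by simp
qed

lemma order_continuous_normD:
  fixes x :: "'i \<Rightarrow> 'a::banach_lattice"
  assumes "order_continuous_norm TYPE('a)" and x: "decreases_to_0 I r x"
  shows "((\<lambda>i. norm (x i)) \<longlongrightarrow> 0) (net_filter I r)"
proof -
  note D = decreases_to_0_range[OF x]
  have dirI: "directed_on I r" and dirD: "directed_on (x ` I) (\<ge>)"
    using x D by (auto simp: decreases_to_0_def)
  have "((\<lambda>d. norm d) \<longlongrightarrow> 0) (net_filter (x ` I) (\<ge>))"
    using assms(1) D unfolding order_continuous_norm_def by blast
  then have D0: "\<exists>i\<in>I. \<forall>j\<in>I. x j \<le> x i \<longrightarrow> norm (x j) < e" if "e > 0" for e
    using that unfolding tendsto_iff eventually_net_filter[OF dirD] by simp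
  have mono: "\<And>i j. i \<in> I \<Longrightarrow> j \<in> I \<Longrightarrow> r i j \<Longrightarrow> x j \<le> x i"
    using x unfolding decreases_to_0_def by blast
  have "\<exists>i\<in>I. \<forall>j\<in>I. r i j \<longrightarrow> norm (x j) < e" if "e > 0" for e
    using D0[OF that] mono by blast
  then show ?thesis
    unfolding tendsto_iff eventually_net_filter[OF dirI] by simp
qed

text \<open>
  Nets are given by a function together with a filter on its index type; sequences use
  \<open>sequentially\<close>. The dominating net \<open>y\<close> need not have the same index set as \<open>x\<close>.
\<close>

definition order_converges :: "('i \<Rightarrow> 'a::banach_lattice) \<Rightarrow> 'a \<Rightarrow> 'i filter \<Rightarrow> bool" where
  "order_converges x l F \<longleftrightarrow>
     (\<exists>(J :: 'a set) r (y :: 'a \<Rightarrow> 'a). decreases_to_0 J r y \<and>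
        (\<forall>j\<in>J. eventually (\<lambda>i. \<bar>x i - l\<bar> \<le> y j) F))"

lemma order_convergesI:
  fixes x :: "'i \<Rightarrow> 'a::banach_lattice" and y :: "'j \<Rightarrow> 'a"
  assumes "decreases_to_0 J r y" and "\<And>j. j \<in> J \<Longrightarrow> eventually (\<lambda>i. \<bar>x i - l\<bar> \<le> y j) F"
  shows "order_converges x l F"
  unfolding order_converges_def using decreases_to_0_range[OF assms(1)] assms(2) by blast

definition uo_converges :: "('i \<Rightarrow> 'a::banach_lattice) \<Rightarrow> 'a \<Rightarrow> 'i filter \<Rightarrow> bool" where
  "uo_converges x l F \<longleftrightarrow> (\<forall>y\<ge>0. order_converges (\<lambda>i. inf \<bar>x i - l\<bar> y) 0 F)"

definition un_converges :: "('i \<Rightarrow> 'a::banach_lattice) \<Rightarrow> 'a \<Rightarrow> 'i filter \<Rightarrow> bool" where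
  "un_converges x l F \<longleftrightarrow> (\<forall>y\<ge>0. ((\<lambda>i. norm (inf \<bar>x i - l\<bar> y)) \<longlongrightarrow> 0) F)"

definition weakly_null :: "(nat \<Rightarrow> 'a::real_normed_vector) \<Rightarrow> bool" where
  "weakly_null x \<longleftrightarrow> (\<forall>f :: 'a \<Rightarrow> real. bounded_linear f \<longrightarrow> (\<lambda>n. f (x n)) \<longlonglongrightarrow> 0)"

definition weakly_Cauchy :: "(nat \<Rightarrow> 'a::real_normed_vector) \<Rightarrow> bool" where
  "weakly_Cauchy x \<longleftrightarrow> (\<forall>f :: 'a \<Rightarrow> real. bounded_linear f \<longrightarrow> Cauchy (\<lambda>n. f (x n)))"

definition uo_demi_Dunford_Pettis :: "('a::banach_lattice \<Rightarrow> 'a) \<Rightarrow> bool" where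
  "uo_demi_Dunford_Pettis T \<longleftrightarrow>
     (\<forall>x :: nat \<Rightarrow> 'a. weakly_null x \<and> uo_converges (\<lambda>n. x n - T (x n)) 0 sequentially
        \<longrightarrow> (\<lambda>n. norm (x n)) \<longlonglongrightarrow> 0)"

end

theory Submission
  imports Defs
begin

text \<open>
  For (2) \<open>\<Longrightarrow>\<close> (1), order continuity turns uo-null into un-null sequences, so a sequence \<open>x\<close> as
  in the definition of (1) satisfies the hypotheses of (2); interleaving it with zeros identifies the
  limit as \<open>0\<close> without the Hahn--Banach theorem. For (1) \<open>\<Longrightarrow>\<close> (2), a sequence that is not Cauchy
  yields weakly null differences \<open>z\<close> bounded away from \<open>0\<close> with \<open>z - T z\<close> un-null. Every un-null
  sequence has a uo-null subsequence, obtained by making its truncations at a single suitable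
  element \<open>e\<close> norm summable, and (1) applied along it gives a contradiction.
\<close>

section \<open>Banach lattices\<close>

context lattice_ab_group_add
begin

text \<open>By distributivity the right-hand side is the infimum of four sums. Three of them contain
  \<open>a\<close> and lie above it by positivity; the fourth is \<open>b + c\<close>.\<close>

lemma inf_add_le:
  assumes "0 \<le> a" "0 \<le> b" "0 \<le> c"
  shows "inf a (b + c) \<le> inf a b + inf a c"
proof -
  have "inf a b + inf a c = inf (inf (a + a) (b + a)) (inf (a + c) (b + c))"
    by (simp add: add_inf_distrib_left add_inf_distrib_right inf_commute inf_assoc inf_left_commute)
  moreover have "a \<le> a + a" "a \<le> b + a" "a \<le> a + c"
    using assms by (simp_all add: add_increasing add_increasing2)
  ultimately show ?thesis
    by (simp add: le_infI1)
qed

end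

text \<open>Each induction step splits off one copy of \<open>e\<close> with
  \<open>inf_add_le\<close>. Smallness of a truncation at \<open>e\<close> thus passes to every
  multiple of \<open>e\<close>.\<close>

lemma inf_scaleR_of_nat_le:
  fixes a e :: "'a::banach_lattice"
  assumes "0 \<le> a" "0 \<le> e"
  shows "inf a (real m *\<^sub>R e) \<le> real m *\<^sub>R inf a e"
proof (induction m)
  case 0
  then show ?case by (simp add: assms)
next
  case (Suc m)
  have "inf a (e + real m *\<^sub>R e) \<le> inf a e + inf a (real m *\<^sub>R e)"
    by (rule inf_add_le) (simp_all add: assms scaleR_nonneg_nonneg)
  also have "\<dots> \<le> inf a e + real m *\<^sub>R inf a e"
    using Suc by simp
  finally show ?case by (simp add: scaleR_left_distrib)
qed

lemma norm_mono_nonneg: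
  fixes x y :: "'a::banach_lattice"
  assumes "0 \<le> x" "x \<le> y"
  shows "norm x \<le> norm y"
  using assms by (intro norm_mono_abs) (simp add: abs_of_nonneg)

lemma norm_abs_lattice [simp]: "norm \<bar>x :: 'a::banach_lattice\<bar> = norm x"
  by (intro antisym norm_mono_abs) simp_all

section \<open>Norm limits, series and the Archimedean property\<close>

text \<open>The negative part of \<open>l\<close> lies below \<open>\<bar>x n - l\<bar>\<close>, so
  its norm is bounded by a null sequence and it vanishes.\<close>

lemma LIMSEQ_nonneg_lattice:
  fixes x :: "nat \<Rightarrow> 'a::banach_lattice"
  assumes lim: "x \<longlonglongrightarrow> l" and nonneg: "\<And>n. 0 \<le> x n"
  shows "0 \<le> l"
proof -
  have bound: "norm (sup (- l) 0) \<le> norm (x n - l)" for n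
  proof -
    have "- l \<le> x n - l" using nonneg[of n] by simp
    then have "- l \<le> \<bar>x n - l\<bar>" using abs_ge_self order_trans by blast
    then have "norm (sup (- l) 0) \<le> norm \<bar>x n - l\<bar>"
      by (intro norm_mono_nonneg) simp_all
    then show ?thesis by simp
  qed
  have "(\<lambda>n. norm (x n - l)) \<longlonglongrightarrow> 0"
    using lim by (simp add: LIM_zero tendsto_norm_zero)
  then have "norm (sup (- l) 0) \<le> 0"
    by (rule LIMSEQ_le_const) (use bound in blast)
  then have "sup (- l) 0 = 0" by simp
  then have "- l \<le> 0" by (metis sup.cobounded1)
  then show ?thesis by simp
qed

lemma LIMSEQ_le_lattice:
  fixes x y :: "nat \<Rightarrow> 'a::banach_lattice"
  assumes "x \<longlonglongrightarrow> a" "y \<longlonglongrightarrow> b" "\<And>n. x n \<le> y n"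
  shows "a \<le> b"
  using LIMSEQ_nonneg_lattice[OF tendsto_diff[OF assms(2,1)]] assms(3) by simp

lemma sum_le_suminf_lattice:
  fixes u :: "nat \<Rightarrow> 'a::banach_lattice"
  assumes "summable u" "\<And>n. 0 \<le> u n"
  shows "sum u {..<n} \<le> suminf u"
proof (rule LIMSEQ_le_lattice)
  show "(\<lambda>k. sum u {..<n}) \<longlonglongrightarrow> sum u {..<n}" by simp
  \<comment> \<open>Shifting the index by \<open>n\<close> makes the comparison with the fixed
    partial sum valid for every \<open>k\<close>.\<close>
  show "(\<lambda>k. sum u {..<k + n}) \<longlonglongrightarrow> suminf u"
    using summable_LIMSEQ[OF assms(1)] by (rule LIMSEQ_ignore_initial_segment)
  show "sum u {..<n} \<le> sum u {..<k + n}" for k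
    by (rule sum_mono2) (use assms(2) in auto)
qed

lemma le_suminf_lattice:
  fixes u :: "nat \<Rightarrow> 'a::banach_lattice"
  assumes "summable u" "\<And>n. 0 \<le> u n"
  shows "u n \<le> suminf u"
proof -
  have "u n \<le> sum u {..<Suc n}"
    using assms(2) by (simp add: sum_nonneg)
  also have "\<dots> \<le> suminf u"
    using assms by (rule sum_le_suminf_lattice)
  finally show ?thesis .
qed

lemma archimedean_lattice:
  fixes z b :: "'a::banach_lattice"
  assumes "\<And>n. real n *\<^sub>R z \<le> b"
  shows "z \<le> 0"
proof (rule LIMSEQ_le_lattice)
  show "(\<lambda>n. z) \<longlonglongrightarrow> z" by simp
  show "(\<lambda>n. inverse (real (Suc n)) *\<^sub>R b) \<longlonglongrightarrow> 0"
    using tendsto_scaleR[OF LIMSEQ_inverse_real_of_nat tendsto_const[of b]] by simp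
  show "z \<le> inverse (real (Suc n)) *\<^sub>R b" for n
    using scaleR_left_mono[OF assms[of "Suc n"], of "inverse (real (Suc n))"] by simp
qed

text \<open>This replaces the supremum of \<open>a\<close>, which need not exist: the gaps between
  upper bounds and terms still have infimum \<open>0\<close>.\<close>

lemma le_0_if_le_upper_bound_gaps:
  fixes a :: "nat \<Rightarrow> 'a::banach_lattice"
  assumes bdd: "\<And>m. a m \<le> y"
    and z: "\<And>b m. (\<And>i. a i \<le> b) \<Longrightarrow> z \<le> b - a m"
  shows "z \<le> 0"
proof -
  \<comment> \<open>If \<open>b\<close> is an upper bound, so is \<open>b - z\<close>; iterate.\<close>
  have ub: "a i \<le> y - real n *\<^sub>R z" for i n
  proof (induction n arbitrary: i)
    case 0
    then show ?case using bdd by simp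
  next
    case (Suc n)
    have "z \<le> (y - real n *\<^sub>R z) - a i"
      using Suc by (rule z)
    then show ?case by (simp add: algebra_simps)
  qed
  have "real n *\<^sub>R z \<le> y - a 0" for n
    using ub[of 0 n] by (simp add: algebra_simps)
  then show ?thesis by (rule archimedean_lattice)
qed

section \<open>Unbounded convergence\<close>

lemma un_converges_compose:
  fixes x :: "'i \<Rightarrow> 'a::banach_lattice"
  assumes "un_converges x l F" "filterlim g F G"
  shows "un_converges (\<lambda>n. x (g n)) l G"
  unfolding un_converges_def
proof (intro allI impI)
  fix y :: 'a
  assume "0 \<le> y"
  then have "((\<lambda>i. norm (inf \<bar>x i - l\<bar> y)) \<longlongrightarrow> 0) F"
    using assms(1) unfolding un_converges_def by blast
  then show "((\<lambda>n. norm (inf \<bar>x (g n) - l\<bar> y)) \<longlongrightarrow> 0) G"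
    using assms(2) by (rule filterlim_compose)
qed

lemma un_converges_diff:
  fixes x y :: "'i \<Rightarrow> 'a::banach_lattice"
  assumes x: "un_converges x 0 F" and y: "un_converges y 0 F"
  shows "un_converges (\<lambda>i. x i - y i) 0 F"
  unfolding un_converges_def
proof (intro allI impI)
  fix c :: 'a
  assume c: "0 \<le> c"
  have le: "norm (inf \<bar>x i - y i\<bar> c) \<le> norm (inf \<bar>x i\<bar> c) + norm (inf \<bar>y i\<bar> c)" for i
  proof -
    have "inf \<bar>x i - y i\<bar> c \<le> inf c (\<bar>x i\<bar> + \<bar>y i\<bar>)"
      using abs_triangle_ineq4[of "x i" "y i"] by (simp add: le_infI1)
    also have "\<dots> \<le> inf c \<bar>x i\<bar> + inf c \<bar>y i\<bar>"
      by (rule inf_add_le) (simp_all add: c)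
    finally have "norm (inf \<bar>x i - y i\<bar> c) \<le> norm (inf c \<bar>x i\<bar> + inf c \<bar>y i\<bar>)"
      by (intro norm_mono_nonneg) (simp_all add: c)
    also have "\<dots> \<le> norm (inf c \<bar>x i\<bar>) + norm (inf c \<bar>y i\<bar>)"
      by (rule norm_triangle_ineq)
    finally show ?thesis by (simp add: inf_commute)
  qed
  have "((\<lambda>i. norm (inf \<bar>x i\<bar> c) + norm (inf \<bar>y i\<bar> c)) \<longlongrightarrow> 0 + 0) F"
    using x y c unfolding un_converges_def by (intro tendsto_add) simp_all
  then show "((\<lambda>i. norm (inf \<bar>x i - y i - 0\<bar> c)) \<longlongrightarrow> 0) F"
    by (rule Lim_null_comparison[rotated, OF tendsto_eq_rhs]) (simp_all add: le)
qed

text \<open>Order continuity provides a member of the dominating net of small norm, and monotonicity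
  of the norm passes this to the truncations that it eventually dominates.\<close>

lemma uo_converges_imp_un_converges:
  fixes x :: "'i \<Rightarrow> 'a::banach_lattice"
  assumes oc: "order_continuous_norm TYPE('a)" and uo: "uo_converges x l F"
  shows "un_converges x l F"
  unfolding un_converges_def
proof (intro allI impI)
  fix c :: 'a
  assume "0 \<le> c"
  then have "order_converges (\<lambda>i. inf \<bar>x i - l\<bar> c) 0 F"
    using uo unfolding uo_converges_def by blast
  then obtain J :: "'a set" and r y where d: "decreases_to_0 J r y"
    and ev: "\<And>j. j \<in> J \<Longrightarrow> eventually (\<lambda>i. abs (inf \<bar>x i - l\<bar> c - 0) \<le> y j) F"
    unfolding order_converges_def by blast
  have dir: "directed_on J r" and nonneg: "\<And>j. j \<in> J \<Longrightarrow> 0 \<le> y j"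
    using d unfolding decreases_to_0_def by blast+
  have lim: "((\<lambda>j. norm (y j)) \<longlongrightarrow> 0) (net_filter J r)"
    using oc d by (rule order_continuous_normD)
  show "((\<lambda>i. norm (inf \<bar>x i - l\<bar> c)) \<longlongrightarrow> 0) F"
  proof (rule tendstoI)
    fix e :: real
    assume "0 < e"
    then have "eventually (\<lambda>j. norm (y j) < e) (net_filter J r)"
      using tendstoD[OF lim] by simp
    then obtain j where j: "j \<in> J" "norm (y j) < e"
      using dir unfolding eventually_net_filter[OF dir] directed_on_def by blast
    from ev[OF j(1)] show "eventually (\<lambda>i. dist (norm (inf \<bar>x i - l\<bar> c)) 0 < e) F"
    proof eventually_elim
      case (elim i)
      then have "norm (inf \<bar>x i - l\<bar> c) \<le> norm (y j)"
        by (intro norm_mono_abs) (use nonneg[OF j(1)] in \<open>simp add: abs_of_nonneg\<close>)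
      then show ?case using j(2) by simp
    qed
  qed
qed

section \<open>Extraction of uo-convergent subsequences\<close>

lemma null_sequence_geometric_subseq:
  fixes f :: "nat \<Rightarrow> real"
  assumes "f \<longlonglongrightarrow> 0"
  obtains r where "strict_mono r" "\<And>k. f (r k) < (1/2) ^ k"
proof -
  have small: "\<exists>n>N. f n < (1/2) ^ k" for N k
  proof -
    have "eventually (\<lambda>n. f n < (1/2) ^ k) sequentially"
      using assms by (rule order_tendstoD) simp
    then have "eventually (\<lambda>n. N < n \<and> f n < (1/2) ^ k) sequentially"
      using eventually_gt_at_top by (rule eventually_conj[rotated])
    then show ?thesis
      using eventually_happens by fastforce
  qed
  have "\<exists>r. \<forall>k. f (r k) < (1/2) ^ k \<and> r k < r (Suc k)"
    by (rule dependent_nat_choice) (use small in blast)+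
  then show ?thesis
    using that by (auto simp: strict_mono_Suc_iff)
qed

lemma un_converges_uo_subseq:
  fixes w :: "nat \<Rightarrow> 'a::banach_lattice"
  assumes un: "un_converges w l sequentially"
  obtains r where "strict_mono r" "uo_converges (\<lambda>k. w (r k)) l sequentially"
proof -
  define a where "a n = \<bar>w n - l\<bar>" for n
  \<comment> \<open>The weights are positive and give
    \<open>norm (c n *\<^sub>R a n) \<le> (1/2) ^ n\<close>, whatever the growth of
    \<open>a\<close>; the 1 in the denominator covers \<open>a n = 0\<close>.\<close>
  define c where "c n = (1/2) ^ n / (1 + norm (a n))" for n
  have a_nonneg: "0 \<le> a n" for n by (simp add: a_def)
  have c_pos: "0 < c n" for n by (simp add: c_def add_pos_nonneg)
  have term_nonneg: "0 \<le> c n *\<^sub>R a n" for n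
    using a_nonneg c_pos by (simp add: scaleR_nonneg_nonneg less_imp_le)
  have "summable (\<lambda>n. c n *\<^sub>R a n)"
  proof (rule summable_comparison_test')
    show "summable (\<lambda>n. (1/2 :: real) ^ n)" by (simp add: summable_geometric)
    show "norm (c n *\<^sub>R a n) \<le> (1/2) ^ n" if "0 \<le> n" for n
    proof -
      have "norm (a n) / (1 + norm (a n)) \<le> 1" by (simp add: add_pos_nonneg)
      then have "(1/2) ^ n * (norm (a n) / (1 + norm (a n))) \<le> (1/2 :: real) ^ n * 1"
        by (intro mult_left_mono) simp_all
      then show ?thesis using c_pos[of n] by (simp add: c_def)
    qed
  qed
  \<comment> \<open>\<open>e\<close> is a quasi-interior point of the closed ideal generated by the \<open>a n\<close>, so that
    uo-convergence of subsequences can be tested against \<open>e\<close> alone.\<close>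
  define e where "e = (\<Sum>n. c n *\<^sub>R a n)"
  have term_le: "c n *\<^sub>R a n \<le> e" for n
    unfolding e_def using \<open>summable (\<lambda>n. c n *\<^sub>R a n)\<close> term_nonneg by (rule le_suminf_lattice)
  have e_nonneg: "0 \<le> e"
    using term_nonneg[of 0] term_le[of 0] by (rule order_trans)
  have dominated: "\<exists>m. a n \<le> real m *\<^sub>R e" for n
  proof -
    obtain m where m: "1 / c n \<le> real m" using real_arch_simple by blast
    have "a n = (1 / c n) *\<^sub>R (c n *\<^sub>R a n)" using c_pos[of n] by simp
    also have "\<dots> \<le> (1 / c n) *\<^sub>R e"
      using c_pos[of n] term_le by (intro scaleR_left_mono) (simp_all add: less_imp_le)
    also have "\<dots> \<le> real m *\<^sub>R e"
      using m e_nonneg by (rule scaleR_right_mono)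
    finally show ?thesis by blast
  qed
  have "(\<lambda>n. norm (inf (a n) e)) \<longlonglongrightarrow> 0"
    using un e_nonneg unfolding un_converges_def a_def by blast
  then obtain r where r: "strict_mono r" and small: "\<And>k. norm (inf (a (r k)) e) < (1/2) ^ k"
    using null_sequence_geometric_subseq by blast
  define u where "u k = inf (a (r k)) e" for k
  have u_nonneg: "0 \<le> u k" for k by (simp add: u_def a_nonneg e_nonneg)
  have u_summable: "summable u"
  proof (rule summable_comparison_test')
    show "summable (\<lambda>n. (1/2 :: real) ^ n)" by (simp add: summable_geometric)
    show "norm (u k) \<le> (1/2) ^ k" if "0 \<le> k" for k
      using small[of k] by (simp add: u_def)
  qed
  \<comment> \<open>The remainders of the series tend to \<open>0\<close> in norm, and since
    \<open>u\<close> is nonnegative, \<open>v j\<close> dominates every \<open>u k\<close> with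
    \<open>k \<ge> j\<close>.\<close>
  define v where "v j = suminf u - sum u {..<j}" for j
  have v_lim: "v \<longlonglongrightarrow> 0"
    using tendsto_diff[OF tendsto_const[of "suminf u"] summable_LIMSEQ[OF u_summable]]
    by (simp add: v_def[abs_def])
  have u_le_v: "u k \<le> v j" if "j \<le> k" for j k
  proof -
    have "sum u {..<j} + u k \<le> sum u {..<Suc k}"
      using that by (simp add: sum_mono2 u_nonneg)
    also have "\<dots> \<le> suminf u"
      using u_summable u_nonneg by (rule sum_le_suminf_lattice)
    finally show ?thesis by (simp add: v_def le_diff_eq add.commute)
  qed
  have v_nonneg: "0 \<le> v j" for j
    using u_nonneg[of j] u_le_v[of j j] by simp
  have "uo_converges (\<lambda>k. w (r k)) l sequentially"
    unfolding uo_converges_def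
  proof (intro allI impI)
    fix y :: 'a
    assume y: "0 \<le> y"
    \<comment> \<open>All eventual upper bounds of the truncations serve as the dominating net. This
      set is closed under \<open>inf\<close>, so the work lies in showing that its infimum is
      \<open>0\<close>.\<close>
    define D where "D = {d. 0 \<le> d \<and> eventually (\<lambda>k. inf (a (r k)) y \<le> d) sequentially}"
    \<comment> \<open>The first summand controls the part of the truncation below
      \<open>real m *\<^sub>R e\<close>, the second the part of it that exceeds this
      multiple.\<close>
    have D_mem: "real m *\<^sub>R v j + (b - inf y (real m *\<^sub>R e)) \<in> D"
      if b: "\<And>i. inf y (real i *\<^sub>R e) \<le> b" for b m j
    proof -
      have "inf (a (r k)) y \<le> real m *\<^sub>R v j + (b - inf y (real m *\<^sub>R e))" if "j \<le> k" for k
      proof -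
        define p where "p = inf (a (r k)) y"
        define q where "q = inf y (real m *\<^sub>R e)"
        \<comment> \<open>The multiple \<open>i\<close> depends on \<open>k\<close>, but
          \<open>b\<close> bounds \<open>inf y (real i *\<^sub>R e)\<close> for all \<open>i\<close>
          at once, so \<open>p \<le> b\<close> holds uniformly.\<close>
        obtain i where "a (r k) \<le> real i *\<^sub>R e" using dominated by blast
        then have "p \<le> inf y (real i *\<^sub>R e)" by (simp add: p_def le_infI1)
        then have "p \<le> b" using b order_trans by blast
        have "p \<le> q + (b - q)" using \<open>p \<le> b\<close> by simp
        then have "p \<le> inf p (q + (b - q))" by simp
        also have "\<dots> \<le> inf p q + inf p (b - q)"
        proof (rule inf_add_le)
          show "0 \<le> p" "0 \<le> q"
            using y a_nonneg e_nonneg by (simp_all add: p_def q_def scaleR_nonneg_nonneg)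
          show "0 \<le> b - q"
            using b[of m] by (simp only: q_def diff_ge_0_iff_ge)
        qed
        also have "\<dots> \<le> inf (a (r k)) (real m *\<^sub>R e) + (b - q)"
          by (intro add_mono) (simp_all add: p_def q_def le_infI1 le_infI2)
        also have "\<dots> \<le> real m *\<^sub>R u k + (b - q)"
          using inf_scaleR_of_nat_le[OF a_nonneg e_nonneg] by (simp add: u_def)
        also have "\<dots> \<le> real m *\<^sub>R v j + (b - q)"
          using u_le_v[OF that] by (simp add: scaleR_left_mono)
        finally show ?thesis by (simp add: p_def q_def)
      qed
      then have "eventually (\<lambda>k. inf (a (r k)) y \<le> real m *\<^sub>R v j + (b - inf y (real m *\<^sub>R e))) sequentially"
        unfolding eventually_sequentially by blast
      moreover have "0 \<le> real m *\<^sub>R v j + (b - inf y (real m *\<^sub>R e))"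
        using v_nonneg b[of m]
        by (intro add_nonneg_nonneg scaleR_nonneg_nonneg) (simp_all only: diff_ge_0_iff_ge of_nat_0_le_iff)
      ultimately show ?thesis by (simp add: D_def)
    qed
    have "decreases_to_0 D (\<ge>) (\<lambda>d. d)"
      unfolding decreases_to_0_def
    proof (intro conjI allI impI)
      have "y \<in> D" by (simp add: D_def y)
      moreover have "inf d d' \<in> D" if "d \<in> D" "d' \<in> D" for d d'
        using that by (auto simp: D_def eventually_conj_iff)
      moreover from this have "\<exists>k\<in>D. d \<ge> k \<and> d' \<ge> k" if "d \<in> D" "d' \<in> D" for d d'
        using that by (intro bexI[of _ "inf d d'"]) simp_all
      ultimately show "directed_on D (\<ge>)"
        unfolding directed_on_def by (intro conjI ballI impI) auto
      fix z
      assume z: "\<forall>d\<in>D. z \<le> d"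
      show "z \<le> 0"
      proof (rule le_0_if_le_upper_bound_gaps)
        show "inf y (real m *\<^sub>R e) \<le> y" for m by simp
        fix b m
        assume b: "\<And>i. inf y (real i *\<^sub>R e) \<le> b"
        \<comment> \<open>With \<open>m\<close> and \<open>b\<close> fixed, letting \<open>j\<close>
          grow removes the term with \<open>v j\<close> and leaves the gap alone.\<close>
        show "z \<le> b - inf y (real m *\<^sub>R e)"
        proof (rule LIMSEQ_le_lattice)
          show "(\<lambda>j. z) \<longlonglongrightarrow> z" by simp
          show "(\<lambda>j. real m *\<^sub>R v j + (b - inf y (real m *\<^sub>R e))) \<longlonglongrightarrow> b - inf y (real m *\<^sub>R e)"
            using tendsto_add[OF tendsto_scaleR[OF tendsto_const v_lim] tendsto_const] by fastforce
          show "z \<le> real m *\<^sub>R v j + (b - inf y (real m *\<^sub>R e))" for j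
            using z D_mem[OF b] by blast
        qed
      qed
    qed (auto simp: D_def)
    then show "order_converges (\<lambda>k. inf \<bar>w (r k) - l\<bar> y) 0 sequentially"
    proof (rule order_convergesI)
      fix d assume "d \<in> D"
      then show "eventually (\<lambda>k. abs (inf \<bar>w (r k) - l\<bar> y - 0) \<le> d) sequentially"
        using y by (simp add: D_def a_def abs_of_nonneg)
    qed
  qed
  with r show ?thesis by (rule that)
qed

section \<open>Weak Cauchy sequences\<close>

lemma weakly_null_subseq:
  assumes "weakly_null x" "strict_mono r"
  shows "weakly_null (\<lambda>k. x (r k))"
  using assms LIMSEQ_subseq_LIMSEQ unfolding weakly_null_def comp_def by blast

lemma weakly_null_imp_weakly_Cauchy: "weakly_null x \<Longrightarrow> weakly_Cauchy x"
  unfolding weakly_null_def weakly_Cauchy_def by (blast intro: LIMSEQ_imp_Cauchy)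

text \<open>For each functional \<open>f\<close> the scalars \<open>f (x i)\<close> have a limit,
  which cancels in the difference. Index sequences chosen from a failing Cauchy condition tend to
  infinity but may fail to be monotone, hence the filter form.\<close>

lemma weakly_Cauchy_diff_weakly_null:
  assumes x: "weakly_Cauchy x"
    and mn: "filterlim m at_top sequentially" "filterlim n at_top sequentially"
  shows "weakly_null (\<lambda>k. x (m k) - x (n k))"
  unfolding weakly_null_def
proof (intro allI impI)
  fix f :: "'a \<Rightarrow> real"
  assume f: "bounded_linear f"
  then obtain L where "(\<lambda>i. f (x i)) \<longlonglongrightarrow> L"
    using x unfolding weakly_Cauchy_def Cauchy_convergent_iff convergent_def by blast
  then have "(\<lambda>k. f (x (m k)) - f (x (n k))) \<longlonglongrightarrow> L - L"
    using mn by (intro tendsto_diff) (auto intro: filterlim_compose)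
  then show "(\<lambda>k. f (x (m k) - x (n k))) \<longlonglongrightarrow> 0"
    using f by (simp add: linear_diff bounded_linear.linear)
qed

text \<open>Since \<open>n div 2\<close> tends to infinity, the interleaved sequence is dominated in
  norm by a null sequence. It is applied both to functional values and to norms of
  truncations.\<close>

lemma interleave_zero_tendsto:
  fixes g :: "nat \<Rightarrow> 'a::real_normed_vector"
  assumes "g \<longlonglongrightarrow> 0"
  shows "(\<lambda>n. if even n then g (n div 2) else 0) \<longlonglongrightarrow> 0"
proof -
  have "filterlim (\<lambda>n. n div 2 :: nat) at_top sequentially"
    unfolding filterlim_at_top eventually_sequentially
    by (metis div_le_mono nonzero_mult_div_cancel_right zero_neq_numeral)
  then have "(\<lambda>n. g (n div 2)) \<longlonglongrightarrow> 0"
    using assms by (rule filterlim_compose[rotated])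
  then show ?thesis
    by (rule tendsto_0_le[where K = 1]) simp
qed

section \<open>The two implications\<close>

lemma uo_demi_Dunford_Pettis_imp_convergent:
  fixes T :: "'a::banach_lattice \<Rightarrow> 'a"
  assumes T: "linear T" and DP: "uo_demi_Dunford_Pettis T"
    and wC: "weakly_Cauchy x" and un: "un_converges (\<lambda>n. x n - T (x n)) 0 sequentially"
  shows "convergent x"
proof (rule ccontr)
  assume "\<not> convergent x"
  \<comment> \<open>Completeness allows the argument to use differences of terms, with no candidate
    for the limit.\<close>
  then have "\<not> Cauchy x" by (simp add: Cauchy_convergent_iff)
  then obtain \<epsilon> where \<epsilon>: "0 < \<epsilon>" "\<forall>k. \<exists>m\<ge>k. \<exists>n\<ge>k. \<epsilon> \<le> norm (x m - x n)"
    unfolding Cauchy_iff by (auto simp: not_less)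
  then obtain m n where mn: "\<And>k. k \<le> m k" "\<And>k. k \<le> n k"
    and far: "\<And>k. \<epsilon> \<le> norm (x (m k) - x (n k))"
    by metis
  have lim: "filterlim m at_top sequentially" "filterlim n at_top sequentially"
    using mn by (auto intro: filterlim_at_top_mono[OF filterlim_ident])
  define z where "z k = x (m k) - x (n k)" for k
  have "un_converges (\<lambda>k. (x (m k) - T (x (m k))) - (x (n k) - T (x (n k)))) 0 sequentially"
    using lim by (intro un_converges_diff[OF un_converges_compose[OF un] un_converges_compose[OF un]])
  moreover have "(x (m k) - T (x (m k))) - (x (n k) - T (x (n k))) = z k - T (z k)" for k
    using T by (simp add: z_def linear_diff algebra_simps)
  ultimately have "un_converges (\<lambda>k. z k - T (z k)) 0 sequentially" by simp
  then obtain r where r: "strict_mono r"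
    and "uo_converges (\<lambda>k. z (r k) - T (z (r k))) 0 sequentially"
    by (rule un_converges_uo_subseq)
  moreover have "weakly_null (\<lambda>k. z (r k))"
    using weakly_null_subseq[OF weakly_Cauchy_diff_weakly_null[OF wC lim] r] by (simp add: z_def)
  ultimately have "(\<lambda>k. norm (z (r k))) \<longlonglongrightarrow> 0"
    using DP unfolding uo_demi_Dunford_Pettis_def by blast
  \<comment> \<open>The lower bound \<open>far\<close> holds at every index, so it survives the
    passage to the subsequence \<open>r\<close>.\<close>
  then have "\<epsilon> \<le> 0"
    by (rule LIMSEQ_le_const) (use far in \<open>auto simp: z_def\<close>)
  with \<epsilon>(1) show False by simp
qed

lemma convergent_imp_uo_demi_Dunford_Pettis:
  fixes T :: "'a::banach_lattice \<Rightarrow> 'a"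
  assumes oc: "order_continuous_norm TYPE('a)" and T: "linear T"
    and conv: "\<And>x. weakly_Cauchy x \<Longrightarrow> un_converges (\<lambda>n. x n - T (x n)) 0 sequentially \<Longrightarrow> convergent x"
  shows "uo_demi_Dunford_Pettis T"
  unfolding uo_demi_Dunford_Pettis_def
proof (intro allI impI, elim conjE)
  fix x :: "nat \<Rightarrow> 'a"
  assume wn: "weakly_null x" and uo: "uo_converges (\<lambda>n. x n - T (x n)) 0 sequentially"
  define z where "z n = (if even n then x (n div 2) else 0)" for n
  have "weakly_null z"
    unfolding weakly_null_def
  proof (intro allI impI)
    fix f :: "'a \<Rightarrow> real"
    assume f: "bounded_linear f"
    then have "(\<lambda>n. f (x n)) \<longlonglongrightarrow> 0"
      using wn unfolding weakly_null_def by blast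
    then have "(\<lambda>n. if even n then f (x (n div 2)) else 0) \<longlonglongrightarrow> 0"
      by (rule interleave_zero_tendsto)
    moreover have "f (z n) = (if even n then f (x (n div 2)) else 0)" for n
      using f by (simp add: z_def linear_0 bounded_linear.linear)
    ultimately show "(\<lambda>n. f (z n)) \<longlonglongrightarrow> 0" by simp
  qed
  moreover have "un_converges (\<lambda>n. z n - T (z n)) 0 sequentially"
    unfolding un_converges_def
  proof (intro allI impI)
    fix y :: 'a
    assume y: "0 \<le> y"
    then have "(\<lambda>n. norm (inf \<bar>x n - T (x n)\<bar> y)) \<longlonglongrightarrow> 0"
      using uo_converges_imp_un_converges[OF oc uo] unfolding un_converges_def by simp
    then have "(\<lambda>n. if even n then norm (inf \<bar>x (n div 2) - T (x (n div 2))\<bar> y) else 0) \<longlonglongrightarrow> 0"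
      by (rule interleave_zero_tendsto)
    \<comment> \<open>At odd positions \<open>z n\<close> is \<open>0\<close> and linearity gives
      \<open>T 0 = 0\<close>, so the truncation vanishes there.\<close>
    moreover have "norm (inf \<bar>z n - T (z n) - 0\<bar> y)
        = (if even n then norm (inf \<bar>x (n div 2) - T (x (n div 2))\<bar> y) else 0)" for n
      using T y by (simp add: z_def linear_0 inf_absorb1)
    ultimately show "(\<lambda>n. norm (inf \<bar>z n - T (z n) - 0\<bar> y)) \<longlonglongrightarrow> 0" by simp
  qed
  ultimately obtain L where L: "z \<longlonglongrightarrow> L"
    using conv weakly_null_imp_weakly_Cauchy unfolding convergent_def by blast
  \<comment> \<open>The even positions of \<open>z\<close> recover \<open>x\<close> and the odd ones
    are constantly \<open>0\<close>, so both have limit \<open>L\<close> and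
    \<open>L = 0\<close>.\<close>
  have "strict_mono (\<lambda>n::nat. 2 * n)" "strict_mono (\<lambda>n::nat. 2 * n + 1)"
    by (simp_all add: strict_mono_def)
  from this[THEN LIMSEQ_subseq_LIMSEQ[OF L]] have "x \<longlonglongrightarrow> L" "(\<lambda>n. 0) \<longlonglongrightarrow> L"
    by (simp_all add: z_def comp_def)
  then have "x \<longlonglongrightarrow> 0" using LIMSEQ_unique tendsto_const by blast
  then show "(\<lambda>n. norm (x n)) \<longlonglongrightarrow> 0" by (rule tendsto_norm_zero)
qed

theorem proposition2p5:
  fixes T :: "'a::banach_lattice \<Rightarrow> 'a"
  assumes "order_continuous_norm TYPE('a)"
    and "bounded_linear T"
  shows "uo_demi_Dunford_Pettis T \<longleftrightarrow>
    (\<forall>x :: nat \<Rightarrow> 'a. weakly_Cauchy x \<and> un_converges (\<lambda>n. x n - T (x n)) 0 sequentially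
       \<longrightarrow> convergent x)"
  using uo_demi_Dunford_Pettis_imp_convergent convergent_imp_uo_demi_Dunford_Pettis[OF assms(1)]
    bounded_linear.linear[OF assms(2)]
  by blast

end
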